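(* If $\mathfrak{g}$ is a non-zero finite-dimensional nilpotent Lie algebra over a field $\mathbb{F}$, then $\mathrm{HL}^n(\mathfrak{g},\mathfrak{g}_{\mathrm{ad}})\neq 0$ for every non-negative integer $n$.
   Context: A Lie algebra $\mathfrak{g}$ is regarded as a left Leibniz algebra (an algebra satisfying $x(yz)=(xy)z+y(xz)$) with product $xy:=[x,y]$. The adjoint bimodule $\mathfrak{g}_{\mathrm{ad}}$ is $\mathfrak{g}$ with $x\cdot m:=xm$ and $m\cdot x:=mx$. $\mathrm{HL}$ denotes Leibniz (not Chevalley-Eilenberg) cohomology. Leibniz cohomology: for a left Leibniz algebra $\mathfrak{L}$, an $\mathfrak{L}$-bimodule $M$ (with left and right actions written $x\cdot m$, $m\cdot x$) and $n\ge 0$ let $\mathrm{CL}^n(\mathfrak{L},M):=\mathrm{Hom}_{\mathbb{F}}(\mathfrak{L}^{\otimes n},M)$ and $\mathrm{d}^n:\mathrm{CL}^n(\mathfrak{L},M)\to\mathrm{CL}^{n+1}(\mathfrak{L},M)$, $$(\mathrm{d}^nf)(x_1\otimes\dots\otimes x_{n+1})=\sum_{j=1}^n(-1)^{j+1}x_j\cdot f(x_1\otimes\dots\otimes\hat{x}_j\otimes\dots\otimes x_{n+1})+(-1)^{n+1}f(x_1\otimes\dots\otimes x_n)\cdot x_{n+1}+\sum_{1\le i<j\le n+1}(-1)^if(x_1\otimes\dots\otimes\hat{x}_i\otimes\dots\otimes x_{j-1}\otimes x_ix_j\otimes x_{j+1}\otimes\dots\otimes x_{n+1}).$$ This is a cochain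 complex, and $\mathrm{HL}^n(\mathfrak{L},M):=\operatorname{Ker}(\mathrm{d}^n)/\operatorname{Im}(\mathrm{d}^{n-1})$ with $\mathrm{d}^{-1}:=0$. *)

theory Defs
  imports Complex_Main
begin

locale left_leibniz_algebra = vector_space scale
  for scale :: "'f::field \<Rightarrow> 'l::ab_group_add \<Rightarrow> 'l" +
  fixes mult :: "'l \<Rightarrow> 'l \<Rightarrow> 'l"
  assumes mult_linear_left: "Vector_Spaces.linear scale scale (\<lambda>x. mult x y)"
    and mult_linear_right: "Vector_Spaces.linear scale scale (\<lambda>y. mult x y)"
    and left_leibniz: "mult x (mult y z) = mult (mult x y) z + mult y (mult x z)"

locale leibniz_bimodule =
  left_leibniz_algebra scale mult + M: vector_space scaleM
  for scale :: "'f::field \<Rightarrow> 'l::ab_group_add \<Rightarrow> 'l"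
    and mult :: "'l \<Rightarrow> 'l \<Rightarrow> 'l"
    and scaleM :: "'f \<Rightarrow> 'm::ab_group_add \<Rightarrow> 'm" +
  fixes lact :: "'l \<Rightarrow> 'm \<Rightarrow> 'm"
    and ract :: "'m \<Rightarrow> 'l \<Rightarrow> 'm"
  assumes lact_linear_left: "Vector_Spaces.linear scale scaleM (\<lambda>x. lact x m)"
    and lact_linear_right: "Vector_Spaces.linear scaleM scaleM (\<lambda>m. lact x m)"
    and ract_linear_left: "Vector_Spaces.linear scaleM scaleM (\<lambda>m. ract m x)"
    and ract_linear_right: "Vector_Spaces.linear scale scaleM (\<lambda>x. ract m x)"
    and LLM: "lact (mult x y) m = lact x (lact y m) - lact y (lact x m)"
    and LML: "ract (lact x m) y = lact x (ract m y) - ract m (mult x y)"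
    and MLL: "ract (ract m x) y = ract m (mult x y) - lact x (ract m y)"

definition omit :: "nat \<Rightarrow> 'a list \<Rightarrow> 'a list" where
  "omit i xs = take i xs @ drop (Suc i) xs"

context leibniz_bimodule
begin

(* An element of Hom(L^{(tensor) n}, M) is given by the corresponding n-linear map
   L^n -> M, encoded as a function on lists of length n that is 0 on all other
   lists, so that equality of cochains is equality of functions. *)
definition cochains :: "nat \<Rightarrow> ('l list \<Rightarrow> 'm) set" where
  "cochains n = {f.
     (\<forall>xs. length xs \<noteq> n \<longrightarrow> f xs = 0) \<and>
     (\<forall>xs i. length xs = n \<longrightarrow> i < n \<longrightarrow>
        Vector_Spaces.linear scale scaleM (\<lambda>x. f (xs[i := x])))}"

(* List positions count from 0: the argument x_{i+1} is xs ! i, which accounts for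
   the shift by one in the signs of the first and last sums. *)
definition coboundary :: "nat \<Rightarrow> ('l list \<Rightarrow> 'm) \<Rightarrow> 'l list \<Rightarrow> 'm" where
  "coboundary n f xs =
     (if length xs = Suc n then
        (\<Sum>j<n. scaleM ((-1) ^ j) (lact (xs ! j) (f (omit j xs))))
        + scaleM ((-1) ^ (n + 1)) (ract (f (take n xs)) (xs ! n))
        + (\<Sum>j\<le>n. \<Sum>i<j. scaleM ((-1) ^ (i + 1))
             (f (omit i (xs[j := mult (xs ! i) (xs ! j)]))))
      else 0)"

definition cocycles :: "nat \<Rightarrow> ('l list \<Rightarrow> 'm) set" where
  "cocycles n = {f \<in> cochains n. coboundary n f = (\<lambda>_. 0)}"

fun coboundaries :: "nat \<Rightarrow> ('l list \<Rightarrow> 'm) set" where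
  "coboundaries 0 = {\<lambda>_. 0}"
| "coboundaries (Suc n) = coboundary n ` cochains n"

definition cohomologous :: "nat \<Rightarrow> (('l list \<Rightarrow> 'm) \<times> ('l list \<Rightarrow> 'm)) set" where
  "cohomologous n =
     {(f, g). f \<in> cocycles n \<and> g \<in> cocycles n \<and> (\<lambda>xs. f xs - g xs) \<in> coboundaries n}"

definition HL :: "nat \<Rightarrow> ('l list \<Rightarrow> 'm) set set" where
  "HL n = cocycles n // cohomologous n"

definition HL_zero :: "nat \<Rightarrow> ('l list \<Rightarrow> 'm) set" where
  "HL_zero n = cohomologous n `` {\<lambda>_. 0}"

lemma zero_in_cochains: "(\<lambda>_. 0) \<in> cochains n"
proof -
  interpret vector_space_pair scale scaleM
    by unfold_locales
  show ?thesis
    by (simp add: cochains_def linear_zero)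
qed

lemma diff_in_cochains:
  assumes "f \<in> cochains n" "g \<in> cochains n"
  shows "(\<lambda>xs. f xs - g xs) \<in> cochains n"
proof -
  interpret vector_space_pair scale scaleM
    by unfold_locales
  show ?thesis
    using assms by (auto simp: cochains_def intro!: linear_compose_sub)
qed

lemma coboundary_diff:
  "coboundary n (\<lambda>xs. f xs - g xs) = (\<lambda>xs. coboundary n f xs - coboundary n g xs)"
proof -
  have L: "lact x (a - b) = lact x a - lact x b" for x a b
    by (rule module_hom.diff[OF module_hom_linearI[OF lact_linear_right]])
  have R: "ract (a - b) x = ract a x - ract b x" for x a b
    by (rule module_hom.diff[OF module_hom_linearI[OF ract_linear_left]])
  show ?thesis
    by (rule ext) (simp add: coboundary_def L R M.scale_right_diff_distrib sum_subtractf sum_negf)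
qed

lemma coboundary_zero: "coboundary n (\<lambda>_. 0) = (\<lambda>_. 0)"
  using coboundary_diff[of n "\<lambda>_. 0" "\<lambda>_. 0"] by simp

lemma zero_in_cocycles: "(\<lambda>_. 0) \<in> cocycles n"
  by (simp add: cocycles_def zero_in_cochains coboundary_zero)

lemma zero_in_coboundaries: "(\<lambda>_. 0) \<in> coboundaries n"
proof (cases n)
  case (Suc k)
  have "coboundary k (\<lambda>_. 0) \<in> coboundary k ` cochains k"
    by (intro imageI zero_in_cochains)
  then show ?thesis
    by (simp add: Suc coboundary_zero)
qed simp

lemma diff_in_coboundaries:
  assumes "f \<in> coboundaries n" "g \<in> coboundaries n"
  shows "(\<lambda>xs. f xs - g xs) \<in> coboundaries n"
proof (cases n)
  case (Suc k)
  then obtain f' g' where "f' \<in> cochains k" "g' \<in> cochains k"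
    "f = coboundary k f'" "g = coboundary k g'"
    using assms by auto
  moreover from this have
    "coboundary k (\<lambda>xs. f' xs - g' xs) \<in> coboundary k ` cochains k"
    by (intro imageI diff_in_cochains)
  ultimately show ?thesis
    by (simp add: Suc coboundary_diff)
qed (use assms in auto)

lemma equiv_cohomologous: "equiv (cocycles n) (cohomologous n)"
proof (rule equivI)
  show "cohomologous n \<subseteq> cocycles n \<times> cocycles n"
    by (auto simp: cohomologous_def)
  show "refl_on (cocycles n) (cohomologous n)"
    using zero_in_coboundaries by (auto simp: refl_on_def cohomologous_def)
  show "sym (cohomologous n)"
  proof (rule symI)
    fix f g
    assume "(f, g) \<in> cohomologous n"
    then show "(g, f) \<in> cohomologous n"
      using diff_in_coboundaries[OF zero_in_coboundaries, of "\<lambda>xs. f xs - g xs"]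
      by (simp add: cohomologous_def)
  qed
  show "trans (cohomologous n)"
  proof (rule transI)
    fix f g h
    assume fg: "(f, g) \<in> cohomologous n" and gh: "(g, h) \<in> cohomologous n"
    then have hg: "(\<lambda>xs. h xs - g xs) \<in> coboundaries n"
      using diff_in_coboundaries[OF zero_in_coboundaries, of "\<lambda>xs. g xs - h xs"]
      by (simp add: cohomologous_def)
    show "(f, h) \<in> cohomologous n"
      using fg gh diff_in_coboundaries[OF _ hg, of "\<lambda>xs. f xs - g xs"]
      by (simp add: cohomologous_def)
  qed
qed

lemma HL_zero_in_HL: "HL_zero n \<in> HL n"
  unfolding HL_def HL_zero_def by (rule quotientI) (rule zero_in_cocycles)

end

locale lie_algebra = vector_space scale
  for scale :: "'f::field \<Rightarrow> 'g::ab_group_add \<Rightarrow> 'g" +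
  fixes bracket :: "'g \<Rightarrow> 'g \<Rightarrow> 'g"
  assumes bracket_linear_left: "Vector_Spaces.linear scale scale (\<lambda>x. bracket x y)"
    and bracket_linear_right: "Vector_Spaces.linear scale scale (\<lambda>y. bracket x y)"
    and bracket_self: "bracket x x = 0"
    and jacobi: "bracket x (bracket y z) + bracket y (bracket z x) + bracket z (bracket x y) = 0"
begin

fun lower_central_series :: "nat \<Rightarrow> 'g set" where
  "lower_central_series 0 = UNIV"
| "lower_central_series (Suc k) = span {bracket x y | x y. y \<in> lower_central_series k}"

definition nilpotent :: bool where
  "nilpotent \<longleftrightarrow> (\<exists>k. lower_central_series k = {0})"

lemma bracket_anticomm: "bracket x y = - bracket y x"
proof -
  have "bracket (x + y) (x + y) = bracket x (x + y) + bracket y (x + y)"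
    by (rule module_hom.add[OF module_hom_linearI[OF bracket_linear_left]])
  also have "\<dots> = bracket x x + bracket x y + (bracket y x + bracket y y)"
    by (simp only: module_hom.add[OF module_hom_linearI[OF bracket_linear_right]])
  finally show ?thesis
    by (simp add: bracket_self eq_neg_iff_add_eq_0)
qed

lemma bracket_minus_right: "bracket x (- y) = - bracket x y"
  by (rule module_hom.neg[OF module_hom_linearI[OF bracket_linear_right]])

lemma bracket_leibniz:
  "bracket x (bracket y z) = bracket (bracket x y) z + bracket y (bracket x z)"
proof -
  have "bracket y (bracket z x) = - bracket y (bracket x z)"
    by (metis bracket_anticomm bracket_minus_right)
  moreover have "bracket z (bracket x y) = - bracket (bracket x y) z"
    by (rule bracket_anticomm)
  ultimately show ?thesis
    using jacobi[of x y z] by (simp add: algebra_simps)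
qed

end

sublocale lie_algebra \<subseteq> left_leibniz_algebra scale bracket
  by (intro left_leibniz_algebra.intro left_leibniz_algebra_axioms.intro vector_space_axioms
      bracket_linear_left bracket_linear_right bracket_leibniz)

sublocale lie_algebra \<subseteq> adjoint: leibniz_bimodule scale bracket scale bracket bracket
proof (intro leibniz_bimodule.intro leibniz_bimodule_axioms.intro left_leibniz_algebra_axioms
    vector_space_axioms bracket_linear_left bracket_linear_right)
  show "bracket (bracket x y) m = bracket x (bracket y m) - bracket y (bracket x m)" for x y m
    using bracket_leibniz[of x y m] by (metis add_diff_cancel)
  show "bracket (bracket x m) y = bracket x (bracket m y) - bracket m (bracket x y)" for x m y
    using bracket_leibniz[of x m y] by (metis add_diff_cancel)
  show "bracket (bracket m x) y = bracket m (bracket x y) - bracket x (bracket m y)" for m x y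
    using bracket_leibniz[of m x y] by (metis add_diff_cancel)
qed

end

theory Submission
  imports Defs
begin

text \<open>
  A nilpotent Lie algebra has a linear functional \<open>\<phi>\<close> that vanishes on brackets, and an element
  \<open>e\<close> with \<open>\<phi> e = 1\<close>. Let \<open>C\<close> be the centralizer of the kernel of \<open>\<phi>\<close>. For \<open>u \<in> C\<close> the cochain
  \<open>\<phi> \<otimes> \<dots> \<otimes> \<phi> \<otimes> u\<close> is a cocycle as soon as its degree is odd or \<open>u\<close> is central. In even degree,
  take \<open>u \<noteq> 0\<close> central: every coboundary vanishes at \<open>(e, \<dots>, e)\<close>, but this cocycle does not.
  In odd degree, take \<open>u \<in> C - [e, C]\<close>, which exists because \<open>ad e\<close> is nilpotent and \<open>C\<close> contains
  the centre. If the cocycle were the coboundary of \<open>h\<close>, its values at \<open>(e, \<dots>, e, y)\<close> would show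
  that \<open>h(e, \<dots>, e) \<in> C\<close> and \<open>u = [e, h(e, \<dots>, e)]\<close>.
\<close>

section \<open>Lists with one entry omitted, and alternating sums of signs\<close>

lemma length_omit: "i < length xs \<Longrightarrow> length (omit i xs) = length xs - 1"
  by (simp add: omit_def)

lemma prod_list_omit:
  fixes g :: "'a \<Rightarrow> 'b::comm_monoid_mult"
  assumes "i < length xs"
  shows "g (xs ! i) * prod_list (map g (omit i xs)) = prod_list (map g xs)"
proof -
  have "prod_list (map g xs) = prod_list (map g (take i xs @ xs ! i # drop (Suc i) xs))"
    using assms by (simp add: id_take_nth_drop [symmetric])
  then show ?thesis
    by (simp add: omit_def mult_ac)
qed

text \<open>Since \<open>i < j\<close>, the updated entry lies behind the omitted one and survives.
  An entry that kills a cochain therefore kills the whole term of the double sum in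
  \<open>coboundary\<close>.\<close>

lemma in_set_omit_update:
  assumes "i < j" "j < length xs"
  shows "a \<in> set (omit i (xs[j := a]))"
proof -
  have "drop (Suc i) (xs[j := a]) ! (j - Suc i) = a" "j - Suc i < length (drop (Suc i) (xs[j := a]))"
    using assms by simp_all
  then have "a \<in> set (drop (Suc i) (xs[j := a]))"
    by (metis nth_mem)
  then show ?thesis
    by (simp add: omit_def)
qed

lemma omit_replicate_append:
  "i < m \<Longrightarrow> omit i (replicate m e @ [y]) = replicate (m - 1) e @ [y]"
  by (simp add: omit_def min_def flip: append_assoc replicate_add)

lemma sum_minus_one_power:
  "(\<Sum>j<m. (-1) ^ j) = (if even m then 0 else (1::'a::ring_1))"
  by (induction m) auto

section \<open>Coboundaries evaluated at nearly constant lists\<close>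

context leibniz_bimodule
begin

lemma HL_neq_zeroI:
  assumes "f \<in> cocycles n" "f \<notin> coboundaries n"
  shows "HL n \<noteq> {HL_zero n}"
proof
  assume "HL n = {HL_zero n}"
  moreover have "cohomologous n `` {f} \<in> HL n"
    unfolding HL_def using assms(1) by (rule quotientI)
  ultimately have "cohomologous n `` {f} = cohomologous n `` {\<lambda>_. 0}"
    by (simp add: HL_zero_def)
  then have "(f, \<lambda>_. 0) \<in> cohomologous n"
    using eq_equiv_class [OF _ equiv_cohomologous zero_in_cocycles] by blast
  then show False
    using assms(2) by (simp add: cohomologous_def)
qed

lemma cochain_zero_arg:
  assumes "h \<in> cochains n" "0 \<in> set xs"
  shows "h xs = 0"
proof (cases "length xs = n")
  case True
  obtain i where i: "i < n" "xs ! i = 0"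
    using assms(2) True by (auto simp: in_set_conv_nth)
  have "Vector_Spaces.linear scale scaleM (\<lambda>x. h (xs[i := x]))"
    using assms(1) True i by (auto simp: cochains_def)
  then have "h (xs[i := 0]) = 0"
    by (rule module_hom.zero [OF module_hom_linearI])
  then show ?thesis
    using i(2) by (metis list_update_id)
qed (use assms(1) in \<open>auto simp: cochains_def\<close>)

text \<open>In the double sum, terms with \<open>j < m\<close> contain \<open>mult e e = 0\<close>.
  Terms with \<open>j = m\<close> agree up to sign, as do the left action terms, so both alternating
  sums collapse to 0 or to a single term by the parity of \<open>m\<close>.\<close>

lemma coboundary_replicate:
  assumes h: "h \<in> cochains m" and e: "mult e e = 0"
  shows "coboundary m h (replicate m e @ [y]) =
    (if even m then - ract (h (replicate m e)) y
     else lact e (h (replicate (m - 1) e @ [y])) - h (replicate (m - 1) e @ [mult e y])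
       + ract (h (replicate m e)) y)"
proof -
  let ?xs = "replicate m e @ [y]"
  let ?s = "\<Sum>j<m. (-1) ^ j :: 'f"
  have 1: "(\<Sum>j<m. scaleM ((-1) ^ j) (lact (?xs ! j) (h (omit j ?xs))))
      = scaleM ?s (lact e (h (replicate (m - 1) e @ [y])))"
    by (simp add: M.scale_sum_left omit_replicate_append nth_append)
  have inner: "h (omit i (?xs[j := mult (?xs ! i) (?xs ! j)])) = 0" if "j < m" "i < j" for i j
  proof -
    have "mult (?xs ! i) (?xs ! j) = 0"
      using that e by (simp add: nth_append)
    then show ?thesis
      using in_set_omit_update [of i j ?xs 0] that h by (auto intro!: cochain_zero_arg)
  qed
  have last: "h (omit i (?xs[m := mult (?xs ! i) (?xs ! m)])) = h (replicate (m - 1) e @ [mult e y])"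
    if "i < m" for i
    using that by (simp add: nth_append list_update_append omit_replicate_append)
  have "(\<Sum>j\<le>m. \<Sum>i<j. scaleM ((-1) ^ (i + 1)) (h (omit i (?xs[j := mult (?xs ! i) (?xs ! j)]))))
      = (\<Sum>i<m. scaleM ((-1) ^ (i + 1)) (h (replicate (m - 1) e @ [mult e y])))"
    by (simp add: inner last flip: lessThan_Suc_atMost del: power_Suc)
  also have "\<dots> = - scaleM ?s (h (replicate (m - 1) e @ [mult e y]))"
    by (simp add: M.scale_sum_left sum_negf)
  finally show ?thesis
    unfolding coboundary_def using 1 by (simp add: sum_minus_one_power nth_append)
qed

end

section \<open>Consequences of nilpotency\<close>

context lie_algebra
begin

lemma bracket_scale_left: "bracket (scale c x) y = scale c (bracket x y)"
  by (rule module_hom.scale [OF module_hom_linearI [OF bracket_linear_left]])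

lemma bracket_scale_right: "bracket x (scale c y) = scale c (bracket x y)"
  by (rule module_hom.scale [OF module_hom_linearI [OF bracket_linear_right]])

lemma bracket_diff_left: "bracket (x - y) z = bracket x z - bracket y z"
  by (rule module_hom.diff [OF module_hom_linearI [OF bracket_linear_left]])

text \<open>The last non-zero term of the lower central series is central; \<open>z\<close> is taken
  from it.\<close>

lemma nilpotent_central_element:
  assumes "nilpotent" "\<exists>x::'g. x \<noteq> 0"
  obtains z where "z \<noteq> 0" "\<And>x. bracket x z = 0"
proof -
  define k where "k = (LEAST k. lower_central_series k = {0})"
  have k: "lower_central_series k = {0}"
    using assms(1) unfolding nilpotent_def k_def by (rule LeastI_ex)
  then have "k \<noteq> 0"
    using assms(2) by (cases k) auto
  then obtain j where j: "k = Suc j"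
    using not0_implies_Suc by blast
  have "lower_central_series j \<noteq> {0}"
    using not_less_Least [of j "\<lambda>k. lower_central_series k = {0}"] j by (simp add: k_def)
  moreover have "0 \<in> lower_central_series j"
    by (cases j) (auto simp: span_zero)
  ultimately obtain z where z: "z \<in> lower_central_series j" "z \<noteq> 0"
    by blast
  have "bracket x z \<in> lower_central_series k" for x
    unfolding j lower_central_series.simps using z(1) by (intro span_base) blast
  then show thesis
    using that z(2) k by blast
qed

text \<open>Iterating the inclusion pushes \<open>C\<close> into every term of the lower central
  series, one of which is zero.\<close>

lemma nilpotent_subset_bracket_image:
  assumes "nilpotent" "C \<subseteq> bracket e ` C"
  shows "C \<subseteq> {0}"
proof -
  have "C \<subseteq> lower_central_series k" for k
  proof (induction k)
    case (Suc k)
    have "bracket e ` C \<subseteq> lower_central_series (Suc k)"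
      using Suc unfolding lower_central_series.simps by (auto intro!: span_base)
    then show ?case
      using assms(2) by blast
  qed simp
  then show ?thesis
    using assms(1) unfolding nilpotent_def by metis
qed

lemma nilpotent_derived_proper:
  assumes "nilpotent" "\<exists>x::'g. x \<noteq> 0"
  shows "lower_central_series 1 \<noteq> UNIV"
proof
  assume *: "lower_central_series 1 = UNIV"
  have "lower_central_series k = UNIV" for k
    by (induction k) (use * in auto)
  then show False
    using assms unfolding nilpotent_def by auto
qed

lemma nilpotent_functional:
  assumes "nilpotent" "\<exists>x::'g. x \<noteq> 0"
  obtains \<phi> e where "Vector_Spaces.linear scale (*) \<phi>" "\<And>x y. \<phi> (bracket x y) = 0" "\<phi> e = 1"
proof -
  interpret F: vector_space "(*) :: 'f \<Rightarrow> 'f \<Rightarrow> 'f"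
    by unfold_locales (auto simp: algebra_simps)
  interpret P: vector_space_pair scale "(*) :: 'f \<Rightarrow> 'f \<Rightarrow> 'f" ..
  let ?D = "lower_central_series 1"
  obtain e where e: "e \<notin> ?D"
    using nilpotent_derived_proper [OF assms] by (metis UNIV_eq_I)
  obtain B where B: "B \<subseteq> ?D" "independent B" "?D \<subseteq> span B"
    by (rule basis_exists [of ?D])
  have "subspace ?D"
    by (simp only: One_nat_def lower_central_series.simps subspace_span)
  with B(1) have "span B \<subseteq> ?D"
    by (rule span_minimal)
  then have "e \<notin> span B"
    using e by blast
  then have "independent (insert e B)"
    using B(2) by (simp add: independent_insert)
  then obtain \<phi> where \<phi>: "Vector_Spaces.linear scale (*) \<phi>"
      "\<forall>x\<in>insert e B. \<phi> x = (if x = e then 1 else 0)"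
    using P.linear_independent_extend [of _ "\<lambda>x. if x = e then 1 else 0"] by blast
  have "\<phi> b = 0" if "b \<in> B" for b
    using \<phi>(2) that e B(1) by auto
  then have "\<phi> b = 0" if "b \<in> span B" for b
    using P.linear_eq_0_on_span [OF \<phi>(1)] that by blast
  moreover have "bracket x y \<in> span B" for x y
  proof -
    have "bracket x y \<in> ?D"
      unfolding One_nat_def lower_central_series.simps by (rule span_base) blast
    then show ?thesis
      using B(3) by blast
  qed
  ultimately show thesis
    using that [OF \<phi>(1), of e] \<phi>(2) by simp
qed

section \<open>Cocycles built from a functional\<close>

definition tensor_power :: "('g \<Rightarrow> 'f) \<Rightarrow> 'g \<Rightarrow> nat \<Rightarrow> 'g list \<Rightarrow> 'g" where
  "tensor_power \<phi> u n xs = (if length xs = n then scale (prod_list (map \<phi> xs)) u else 0)"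

lemma tensor_power_replicate:
  "\<phi> e = 1 \<Longrightarrow> tensor_power \<phi> u n (replicate n e) = u"
  by (simp add: tensor_power_def)

lemma tensor_power_eq_0: "a \<in> set xs \<Longrightarrow> \<phi> a = 0 \<Longrightarrow> tensor_power \<phi> u n xs = 0"
  by (force simp: tensor_power_def prod_list_zero_iff)

lemma tensor_power_cochain:
  assumes "Vector_Spaces.linear scale (*) \<phi>"
  shows "tensor_power \<phi> u n \<in> adjoint.cochains n"
proof -
  have "Vector_Spaces.linear scale scale (\<lambda>x. tensor_power \<phi> u n (xs[i := x]))"
    if "length xs = n" "i < n" for xs i
  proof -
    \<comment> \<open>The factors at positions other than \<open>i\<close> do not involve
      \<open>x\<close>, so the cochain depends on \<open>x\<close> only through
      \<open>\<phi> x * c\<close>.\<close>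
    define c where "c = prod_list (map \<phi> (omit i xs))"
    have "prod_list (map \<phi> (xs[i := x])) = \<phi> x * c" for x
      using prod_list_omit [of i "xs[i := x]" \<phi>] that by (simp add: c_def omit_def)
    then have "tensor_power \<phi> u n (xs[i := x]) = scale (\<phi> x * c) u" for x
      using that by (simp add: tensor_power_def)
    moreover have "\<phi> (x + y) = \<phi> x + \<phi> y" "\<phi> (scale r x) = r * \<phi> x" for x y r
      using module_hom.add [OF module_hom_linearI [OF assms]]
        module_hom.scale [OF module_hom_linearI [OF assms]] by auto
    ultimately show ?thesis
      by unfold_locales (auto simp: algebra_simps)
  qed
  then show ?thesis
    by (auto simp: adjoint.cochains_def tensor_power_def)
qed

text \<open>The double sum vanishes because \<open>\<phi>\<close> kills brackets. Each action term
  is \<open>scale p w\<close> up to sign, and antisymmetry gives the right action the sign that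
  continues the alternation. The \<open>n + 1\<close> signs cancel for odd \<open>n\<close>.\<close>

lemma tensor_power_cocycle:
  assumes \<phi>: "Vector_Spaces.linear scale (*) \<phi>" "\<And>x y. \<phi> (bracket x y) = 0"
    and u: "\<And>x. bracket x u = scale (\<phi> x) w"
    and n: "odd n \<or> w = 0"
  shows "tensor_power \<phi> u n \<in> adjoint.cocycles n"
proof -
  let ?f = "tensor_power \<phi> u n"
  have "adjoint.coboundary n ?f xs = 0" for xs
  proof (cases "length xs = Suc n")
    case True
    define p where "p = prod_list (map \<phi> xs)"
    have act: "bracket (xs ! j) (?f (omit j xs)) = scale p w" if "j \<le> n" for j
      using True that prod_list_omit [of j xs \<phi>]
      by (simp add: tensor_power_def length_omit bracket_scale_right u p_def mult.commute)
    have "bracket (?f (take n xs)) (xs ! n) = - scale p w"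
      using act [of n] True by (subst bracket_anticomm) (simp add: omit_def)
    moreover have "?f (omit i (xs[j := bracket (xs ! i) (xs ! j)])) = 0" if "i < j" "j \<le> n" for i j
      using that True by (intro tensor_power_eq_0 [OF in_set_omit_update] \<phi>(2)) simp_all
    ultimately have "adjoint.coboundary n ?f xs
        = (\<Sum>j<n. scale ((-1) ^ j) (scale p w)) + scale ((-1) ^ n) (scale p w)"
      using True act by (simp add: adjoint.coboundary_def)
    also have "\<dots> = scale (\<Sum>j<Suc n. (-1) ^ j) (scale p w)"
      by (simp only: scale_sum_left sum.lessThan_Suc scale_left_distrib)
    also have "\<dots> = 0"
      using n unfolding sum_minus_one_power by auto
    finally show ?thesis .
  qed (simp add: adjoint.coboundary_def)
  then show ?thesis
    using tensor_power_cochain [OF \<phi>(1)] by (auto simp: adjoint.cocycles_def)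
qed

text \<open>The element \<open>x - scale (\<phi> x) e\<close> lies in the kernel of
  \<open>\<phi>\<close> and so commutes with \<open>u\<close>.\<close>

lemma bracket_centralizer_ker:
  assumes \<phi>: "Vector_Spaces.linear scale (*) \<phi>" "\<phi> e = 1"
    and u: "\<And>y. \<phi> y = 0 \<Longrightarrow> bracket y u = 0"
  shows "bracket x u = scale (\<phi> x) (bracket e u)"
proof -
  have "\<phi> (x - scale (\<phi> x) e) = 0"
    using module_hom.diff [OF module_hom_linearI [OF \<phi>(1)]]
      module_hom.scale [OF module_hom_linearI [OF \<phi>(1)]] \<phi>(2) by simp
  from u [OF this] show ?thesis
    by (simp add: bracket_diff_left bracket_scale_left)
qed

text \<open>For \<open>y = e\<close> in \<open>coboundary_replicate\<close>, the middle term
  contains \<open>bracket e e = 0\<close> and the two actions of \<open>e\<close> cancel by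
  antisymmetry.\<close>

lemma coboundary_replicate_odd:
  assumes "h \<in> adjoint.cochains m" "odd m"
  shows "adjoint.coboundary m h (replicate (Suc m) e) = 0"
proof -
  have eq: "replicate (m - 1) e @ [e] = replicate m e"
    using assms(2) by (cases m) (simp_all add: replicate_append_same)
  have "h (replicate (m - 1) e @ [bracket e e]) = 0"
    by (rule adjoint.cochain_zero_arg [OF assms(1)]) (simp add: bracket_self)
  moreover have "replicate (Suc m) e = replicate m e @ [e]"
    by (simp add: replicate_append_same)
  ultimately show ?thesis
    using assms adjoint.coboundary_replicate [OF assms(1) bracket_self, of e e]
      bracket_anticomm [of e "h (replicate m e)"] by (simp add: eq [simplified])
qed

section \<open>Non-trivial classes in even and odd degree\<close>

theorem nilpotent_HL_neq_zero:
  assumes "nilpotent" "\<exists>x::'g. x \<noteq> 0"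
  shows "adjoint.HL n \<noteq> {adjoint.HL_zero n}"
proof -
  obtain \<phi> e where \<phi>: "Vector_Spaces.linear scale (*) \<phi>" "\<And>x y. \<phi> (bracket x y) = 0"
    and e: "\<phi> e = 1"
    using nilpotent_functional [OF assms] by blast
  obtain z where z: "z \<noteq> 0" "\<And>x. bracket x z = 0"
    using nilpotent_central_element [OF assms] by blast
  show ?thesis
  proof (cases "even n")
    case True
    have "tensor_power \<phi> z n \<in> adjoint.cocycles n"
      using \<phi> z(2) by (intro tensor_power_cocycle [where w = 0]) auto
    \<comment> \<open>In degree 0 the only coboundary is zero; otherwise the preceding degree is
      odd.\<close>
    moreover have "f (replicate n e) = 0" if "f \<in> adjoint.coboundaries n" for f
      using that True coboundary_replicate_odd by (cases n) (auto simp del: replicate_Suc)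
    then have "tensor_power \<phi> z n \<notin> adjoint.coboundaries n"
      using z(1) tensor_power_replicate [of \<phi> e z n] e by metis
    ultimately show ?thesis
      by (rule adjoint.HL_neq_zeroI)
  next
    case False
    then obtain m where m: "n = Suc m" "even m"
      by (cases n) auto
    define C where "C = {u. \<forall>y. \<phi> y = 0 \<longrightarrow> bracket y u = 0}"
    \<comment> \<open>The central element \<open>z\<close> is a non-zero member of
      \<open>C\<close>.\<close>
    have "\<not> C \<subseteq> bracket e ` C"
      using nilpotent_subset_bracket_image [OF assms(1)] z by (auto simp: C_def)
    then obtain u where u: "u \<in> C" "u \<notin> bracket e ` C"
      by blast
    let ?f = "tensor_power \<phi> u n"
    have "bracket x u = scale (\<phi> x) (bracket e u)" for x
      using u(1) by (intro bracket_centralizer_ker [OF \<phi>(1) e]) (simp add: C_def)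
    then have "?f \<in> adjoint.cocycles n"
      by (rule tensor_power_cocycle [OF \<phi>]) (simp add: False)
    moreover have "?f \<notin> adjoint.coboundaries n"
    proof
      assume "?f \<in> adjoint.coboundaries n"
      then obtain h where h: "h \<in> adjoint.cochains m" "?f = adjoint.coboundary m h"
        using m by auto
      define v where "v = h (replicate m e)"
      \<comment> \<open>As \<open>m\<close> is even, only the right action survives:
        \<open>- bracket v y = bracket y v\<close>.\<close>
      have v: "?f (replicate m e @ [y]) = bracket y v" for y
        using adjoint.coboundary_replicate [OF h(1) bracket_self, of e y] m(2)
          bracket_anticomm [of y v] by (simp add: h(2) v_def)
      \<comment> \<open>The last argument \<open>y\<close> contributes the factor
        \<open>\<phi> y = 0\<close> to the left side of \<open>v\<close>.\<close>
      have "bracket y v = 0" if "\<phi> y = 0" for y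
        using v [of y] tensor_power_eq_0 [of y "replicate m e @ [y]"] that by simp
      then have "v \<in> C"
        by (simp add: C_def)
      moreover have "bracket e v = u"
        using v [of e] tensor_power_replicate [of \<phi> e u n] e m(1)
        by (simp add: replicate_append_same)
      ultimately show False
        using u(2) by blast
    qed
    ultimately show ?thesis
      by (rule adjoint.HL_neq_zeroI)
  qed
qed

end

theorem corollary4p7:
  fixes scale :: "'f::field \<Rightarrow> 'g::ab_group_add \<Rightarrow> 'g"
    and bracket :: "'g \<Rightarrow> 'g \<Rightarrow> 'g"
    and n :: nat
  assumes "lie_algebra scale bracket"
    and "\<exists>B. finite_dimensional_vector_space scale B"
    and "lie_algebra.nilpotent scale bracket"
    and "\<exists>x::'g. x \<noteq> 0"
  shows "leibniz_bimodule.HL scale bracket scale bracket bracket n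
         \<noteq> {leibniz_bimodule.HL_zero scale bracket scale bracket bracket n}"
  using lie_algebra.nilpotent_HL_neq_zero [OF assms(1,3,4)] .

end
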